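(* Let $k\in\mathbb{Z}^+$ and let $n\geq 2k+1$. Then $$\frac1{n!}\sum_{\pi\in\mathcal{S}_n}\operatorname{des}(\pi^k)=\frac{n-1}2-\frac{\tau^2(k)-\tau(k)-\tau_{\mathrm{o}}(k)+\sigma(k)}{2n}.$$
   Context: $\mathcal{S}_n$ is the symmetric group on $[n]=\{1,\dots,n\}$. For $\pi\in\mathcal{S}_n$, a descent of $\pi$ is an index $i\in[n-1]$ with $\pi(i)>\pi(i+1)$, and $\operatorname{des}(\pi)$ is the number of descents. For $k\in\mathbb{Z}^+$, $\tau(k)$ is the number of positive divisors of $k$, $\sigma(k)$ is the sum of the positive divisors of $k$, $\nu_2(k)$ is the exponent of $2$ in the prime factorization of $k$, and $\tau_{\mathrm{o}}(k)=\tau(k/2^{\nu_2(k)})$ is the number of odd positive divisors of $k$. *)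

theory Defs
  imports
    "HOL-Combinatorics.Permutations"
    "HOL-Computational_Algebra.Primes"
    Complex_Main
begin

text \<open>Elements of the symmetric group on \<open>[n]\<close> are functions on \<open>nat\<close> with
  \<open>\<pi> permutes {1..n}\<close>; the \<open>k\<close>-th power in the group is the iterate \<open>\<pi> ^^ k\<close>.\<close>

definition descents :: "nat \<Rightarrow> (nat \<Rightarrow> nat) \<Rightarrow> nat set" where
  "descents n \<pi> = {i \<in> {1..n - 1}. \<pi> i > \<pi> (i + 1)}"

definition des :: "nat \<Rightarrow> (nat \<Rightarrow> nat) \<Rightarrow> nat" where
  "des n \<pi> = card (descents n \<pi>)"

text \<open>The divisor functions below are meant for positive arguments only.\<close>

definition tau :: "nat \<Rightarrow> nat" where
  "tau k = card {d. d dvd k}"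

definition sigma :: "nat \<Rightarrow> nat" where
  "sigma k = \<Sum>{d. d dvd k}"

definition tau_odd :: "nat \<Rightarrow> nat" where
  "tau_odd k = tau (k div 2 ^ multiplicity 2 k)"

end

theory Submission
  imports Defs "HOL-Combinatorics.Cycles"
begin

text \<open>
  Conjugating \<open>\<pi>\<close> by the transposition of \<open>i\<close> and \<open>i + 1\<close> toggles whether \<open>i\<close> is a descent of
  \<open>\<pi>\<^sup>k\<close>, unless \<open>\<pi>\<^sup>k\<close> fixes both points (never a descent) or exchanges them (always one). Hence the
  probability of a descent at \<open>i\<close> is one half, corrected by the probabilities of these two events.
  Let \<open>a = i\<close> and \<open>b = i + 1\<close>. Exactly \<open>(n - 2)!\<close> permutations have \<open>a\<close> and \<open>b\<close> in different cycles of
  prescribed lengths \<open>d\<close> and \<open>e\<close>, and exactly \<open>(n - 2)!\<close> have \<open>a\<close> in a cycle of length \<open>d\<close> and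
  \<open>\<pi>\<^sup>j a = b\<close>, where \<open>0 < j < d\<close>; this follows by induction on \<open>d\<close>, deleting \<open>\<pi> a\<close> from the cycle of \<open>a\<close>.
  Fixing both points amounts to \<open>\<tau>(k)\<^sup>2\<close> cases of the first kind and \<open>\<sigma>(k) - \<tau>(k)\<close> of the second;
  exchanging them amounts to one case of the second kind for each divisor of \<open>2 k\<close> that does not
  divide \<open>k\<close>, and there are \<open>\<tau>\<^sub>o(k)\<close> of these.
\<close>

section \<open>Inserting a point into a cycle and deleting it again\<close>

text \<open>\<open>insert_after a c q\<close> inserts the fixed point \<open>c\<close> of \<open>q\<close> into the cycle of \<open>a\<close>, right after \<open>a\<close>.\<close>

definition insert_after :: "'a \<Rightarrow> 'a \<Rightarrow> ('a \<Rightarrow> 'a) \<Rightarrow> 'a \<Rightarrow> 'a" where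
  "insert_after a c q = q \<circ> transpose a c"

lemma insert_after_apply:
  assumes "q c = c"
  shows "insert_after a c q a = c" "insert_after a c q c = q a"
    "x \<noteq> a \<Longrightarrow> x \<noteq> c \<Longrightarrow> insert_after a c q x = q x"
  using assms by (auto simp: insert_after_def transpose_apply_other)

lemma funpow_fixed: "q c = c \<Longrightarrow> (q ^^ j) c = c"
  by (induction j) auto

lemma funpow_eq_fixed_iff:
  assumes "inj q" "q c = c"
  shows "(q ^^ j) x = c \<longleftrightarrow> x = c"
  using assms by (metis funpow_fixed inj_fn injD)

lemma funpow_neq_below_least_power:
  "0 < j \<Longrightarrow> j < least_power q a \<Longrightarrow> (q ^^ j) a \<noteq> a"
  using least_power_le[of j q a] by auto

text \<open>After the detour through \<open>c\<close> at the first step, the new orbit of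
  \<open>a\<close> follows the old one with a delay of one step. A second detour would need a return
  to \<open>a\<close>, and \<open>q\<close> makes none before step \<open>least_power q a\<close>;
  hence the upper bound on \<open>j\<close>.\<close>

lemma funpow_insert_after:
  assumes q: "inj q" "q c = c" and "c \<noteq> a" "0 < j" "j \<le> least_power q a"
  shows "(insert_after a c q ^^ Suc j) a = (q ^^ j) a"
  using assms(4,5)
proof (induction j rule: nat_induct_non_zero)
  case 1
  then show ?case by (simp add: insert_after_apply q)
next
  case (Suc j)
  then have "(q ^^ j) a \<noteq> a"
    by (intro funpow_neq_below_least_power) auto
  moreover have "(q ^^ j) a \<noteq> c"
    using funpow_eq_fixed_iff[OF q] \<open>c \<noteq> a\<close> by metis
  ultimately show ?case
    using Suc by (simp add: insert_after_apply q)
qed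

lemma permutation_insert_after: "permutation q \<Longrightarrow> permutation (insert_after a c q)"
  unfolding insert_after_def by (intro permutation_compose permutation_swap_id)

text \<open>The delayed orbit closes up one step later than before. It does not close up earlier:
  its first step leads to \<open>c\<close>, and each later one to an iterate of \<open>q\<close>
  that has not yet returned to \<open>a\<close>.\<close>

lemma least_power_insert_after:
  assumes q: "permutation q" "q c = c" and "c \<noteq> a"
  shows "least_power (insert_after a c q) a = Suc (least_power q a)"
proof -
  let ?p = "insert_after a c q" and ?l = "least_power q a"
  have inj: "inj q"
    using q(1) permutation_bijective bij_is_inj by blast
  have l: "?l > 0" "(q ^^ ?l) a = a"
    using least_power_of_permutation[OF q(1)] by auto
  have return: "(?p ^^ Suc ?l) a = a"
    using funpow_insert_after[OF inj q(2) \<open>c \<noteq> a\<close>] l by simp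
  have "(?p ^^ i) a \<noteq> a" if "0 < i" "i \<le> ?l" for i
  proof (cases "i = 1")
    case True
    then show ?thesis using \<open>c \<noteq> a\<close> by (simp add: insert_after_apply q)
  next
    case False
    then obtain j where j: "i = Suc j" "0 < j"
      using \<open>0 < i\<close> by (cases i) auto
    then show ?thesis
      using funpow_insert_after[OF inj q(2) \<open>c \<noteq> a\<close>, of j] that
        funpow_neq_below_least_power[of j q a] by simp
  qed
  moreover have "(?p ^^ least_power ?p a) a = a" "least_power ?p a > 0"
    using least_power_of_permutation[OF permutation_insert_after[OF q(1)]] by auto
  moreover have "least_power ?p a \<le> Suc ?l"
    using least_power_le[OF return] by simp
  ultimately show ?thesis
    by (metis le_SucE)
qed

lemma funpow_insert_after_avoiding:
  assumes "inj q" "q c = c" "b \<noteq> c" "\<And>j. (q ^^ j) b \<noteq> a"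
  shows "(insert_after a c q ^^ j) b = (q ^^ j) b"
proof (induction j)
  case (Suc j)
  then show ?case
    using assms funpow_eq_fixed_iff[OF assms(1,2), of j b] by (simp add: insert_after_apply)
qed simp

text \<open>The only preimage of \<open>c\<close> under the new map is \<open>a\<close>. An orbit
  that starts at \<open>b \<noteq> c\<close> and avoids \<open>a\<close> therefore avoids
  \<open>c\<close> too, so it never meets the two points where the maps differ.\<close>

lemma insert_after_avoids_iff:
  assumes q: "inj q" "q c = c" and "b \<noteq> c"
  shows "(\<forall>j. (insert_after a c q ^^ j) b \<noteq> a) \<longleftrightarrow> (\<forall>j. (q ^^ j) b \<noteq> a)"
proof
  assume av: "\<forall>j. (insert_after a c q ^^ j) b \<noteq> a"
  have inj: "inj (insert_after a c q)"
    unfolding insert_after_def using q by (intro inj_compose) auto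
  have neq: "(insert_after a c q ^^ j) b \<noteq> c" for j
  proof (cases j)
    case 0
    then show ?thesis using \<open>b \<noteq> c\<close> by simp
  next
    case (Suc i)
    have "insert_after a c q ((insert_after a c q ^^ i) b) \<noteq> insert_after a c q a"
      using av inj by (metis injD)
    then show ?thesis using Suc by (simp add: insert_after_apply q)
  qed
  have "(insert_after a c q ^^ j) b = (q ^^ j) b" for j
  proof (induction j)
    case (Suc j)
    then have "(q ^^ j) b \<noteq> a" "(q ^^ j) b \<noteq> c"
      using av neq by metis+
    with Suc show ?case
      using insert_after_apply(3)[of q c] q by simp
  qed simp
  then show "\<forall>j. (q ^^ j) b \<noteq> a" using av by metis
next
  assume "\<forall>j. (q ^^ j) b \<noteq> a"
  then show "\<forall>j. (insert_after a c q ^^ j) b \<noteq> a"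
    using funpow_insert_after_avoiding[OF q \<open>b \<noteq> c\<close>] by simp
qed

lemma least_power_insert_after_avoiding:
  assumes "inj q" "q c = c" "b \<noteq> c" "\<And>j. (q ^^ j) b \<noteq> a"
  shows "least_power (insert_after a c q) b = least_power q b"
  unfolding least_power_def using funpow_insert_after_avoiding[OF assms] by simp

text \<open>Composing with the same transposition again undoes the insertion: it turns
  \<open>c = p a\<close> into a fixed point and so deletes it from the cycle of
  \<open>a\<close>.\<close>

lemma bij_betw_insert_after:
  assumes "a \<in> S" "c \<in> S" "c \<noteq> a"
  shows "bij_betw (insert_after a c) {q. q permutes S - {c}} {p. p permutes S \<and> p a = c}"
proof (rule bij_betwI[where g = "\<lambda>p. p \<circ> transpose a c"])
  show "insert_after a c \<in> {q. q permutes S - {c}} \<rightarrow> {p. p permutes S \<and> p a = c}"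
  proof safe
    fix q assume "q permutes S - {c}"
    then have "q permutes S" "q c = c"
      using permutes_subset[of q "S - {c}" S] permutes_not_in[of q _ c] by auto
    then show "insert_after a c q permutes S" "insert_after a c q a = c"
      using assms by (auto simp: insert_after_def intro!: permutes_compose permutes_swap_id)
  qed
  show "(\<lambda>p. p \<circ> transpose a c) \<in> {p. p permutes S \<and> p a = c} \<rightarrow> {q. q permutes S - {c}}"
  proof safe
    fix p assume p: "p permutes S" "c = p a"
    have "p \<circ> transpose a (p a) permutes S"
      using p assms by (intro permutes_compose permutes_swap_id) auto
    then show "p \<circ> transpose a (p a) permutes S - {p a}"
      by (rule permutes_superset) (use p in auto)
  qed
qed (auto simp: insert_after_def o_assoc[symmetric])

text \<open>This is the induction step of all the counts below: split by the value
  \<open>c = p a\<close>, then delete \<open>c\<close>. The set \<open>C\<close> may be any set of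
  candidates that contains every value allowed by \<open>P\<close>; it omits \<open>a\<close>, since
  a point cannot be inserted after itself.\<close>

lemma card_permutes_image_in:
  assumes "finite S" "a \<in> S" "C \<subseteq> S - {a}" and "\<And>p. p permutes S \<Longrightarrow> P p \<Longrightarrow> p a \<in> C"
  shows "card {p. p permutes S \<and> P p}
    = (\<Sum>c\<in>C. card {q. q permutes S - {c} \<and> P (insert_after a c q)})"
proof -
  have fin: "finite C" "\<And>T. T \<subseteq> S \<Longrightarrow> finite {p. p permutes T}"
    using assms(1,3) by (auto intro: finite_subset finite_permutations)
  have "{p. p permutes S \<and> P p} = (\<Union>c\<in>C. {p. p permutes S \<and> p a = c \<and> P p})"
    using assms(4) by auto
  also have "card \<dots> = (\<Sum>c\<in>C. card {p. p permutes S \<and> p a = c \<and> P p})"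
    using fin by (intro card_UN_disjoint) (auto intro: finite_subset[OF _ fin(2)[of S]])
  also have "\<dots> = (\<Sum>c\<in>C. card {q. q permutes S - {c} \<and> P (insert_after a c q)})"
  proof (rule sum.cong)
    fix c assume "c \<in> C"
    then have bij: "bij_betw (insert_after a c) {q. q permutes S - {c}} {p. p permutes S \<and> p a = c}"
      using assms by (intro bij_betw_insert_after) auto
    have "bij_betw (insert_after a c) {q. q permutes S - {c} \<and> P (insert_after a c q)}
      {p. p permutes S \<and> p a = c \<and> P p}"
    proof (rule bij_betw_subset[OF bij])
      have "insert_after a c ` {q. q permutes S - {c} \<and> P (insert_after a c q)}
        = {p \<in> insert_after a c ` {q. q permutes S - {c}}. P p}"
        by auto
      then show "insert_after a c ` {q. q permutes S - {c} \<and> P (insert_after a c q)}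
        = {p. p permutes S \<and> p a = c \<and> P p}"
        unfolding bij_betw_imp_surj_on[OF bij] by auto
    qed auto
    then show "card {p. p permutes S \<and> p a = c \<and> P p}
      = card {q. q permutes S - {c} \<and> P (insert_after a c q)}"
      by (simp add: bij_betw_same_card)
  qed simp
  finally show ?thesis .
qed

section \<open>Counting permutations with prescribed cycle lengths and offsets\<close>

lemma permutes_fixing_iff: "a \<in> S \<Longrightarrow> p permutes S \<and> p a = a \<longleftrightarrow> p permutes S - {a}"
  using permutes_superset[of p S "S - {a}"] permutes_subset[of p "S - {a}" S]
    permutes_not_in[of p "S - {a}" a] by auto

lemma least_power_eq_1_iff:
  assumes "permutation p"
  shows "least_power p a = 1 \<longleftrightarrow> p a = a"
  using least_power_dvd[OF assms, of a 1] by auto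

lemma permutes_least_power_eq_1_iff:
  assumes "finite S" "a \<in> S"
  shows "p permutes S \<and> least_power p a = 1 \<longleftrightarrow> p permutes S - {a}"
proof -
  have "permutation p" if "p permutes S"
    using that assms(1) by (auto simp: permutation_permutes)
  then show ?thesis
    using permutes_fixing_iff[OF assms(2), of p] least_power_eq_1_iff[of p a] by auto
qed

text \<open>Deleting \<open>p a\<close> shortens the cycle of \<open>a\<close> by one. Each of the
  \<open>card S - 1\<close> possible values of \<open>p a\<close> contributes
  \<open>fact (card S - 2)\<close>, so the count is the same for every \<open>d\<close>.\<close>

lemma card_permutes_least_power:
  assumes "finite S" "a \<in> S" "0 < d" "d \<le> card S"
  shows "card {p. p permutes S \<and> least_power p a = d} = fact (card S - 1)"
  using assms(3,1,2,4)
proof (induction d arbitrary: S rule: nat_induct_non_zero)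
  case 1
  then have "{p. p permutes S \<and> least_power p a = 1} = {p. p permutes S - {a}}"
    by (simp only: permutes_least_power_eq_1_iff)
  then show ?case
    using 1 by (simp add: card_permutations)
next
  case (Suc d)
  have perm: "permutation p" if "p permutes T" "T \<subseteq> S" for p T
    using that Suc.prems(1) finite_subset by (auto simp: permutation_permutes)
  have "p a \<in> S - {a}" if "p permutes S" "least_power p a = Suc d" for p
    using that least_power_eq_1_iff[OF perm[of p S], of a] Suc.prems Suc.hyps
    by (auto simp: permutes_in_image)
  then have "card {p. p permutes S \<and> least_power p a = Suc d}
    = (\<Sum>c\<in>S - {a}. card {q. q permutes S - {c} \<and> least_power (insert_after a c q) a = Suc d})"
    using Suc.prems by (intro card_permutes_image_in) auto
  also have "\<dots> = (\<Sum>c\<in>S - {a}. card {q. q permutes S - {c} \<and> least_power q a = d})"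
    by (intro sum.cong arg_cong[where f = card] Collect_cong conj_cong refl)
      (auto simp: least_power_insert_after[OF perm] permutes_not_in)
  also have "\<dots> = (\<Sum>c\<in>S - {a}. fact (card S - 2))"
    using Suc.prems by (intro sum.cong) (auto simp: Suc.IH numeral_2_eq_2)
  also have "\<dots> = (card S - 1) * fact (card S - 2)"
    using Suc.prems by simp
  also have "\<dots> = fact (card S - 1)"
    using Suc.prems Suc.hyps fact_reduce[of "card S - 1", where 'a = nat]
    by (simp add: numeral_2_eq_2)
  finally show ?case .
qed

text \<open>Deleting \<open>p a\<close> leaves the cycle of \<open>b\<close> untouched and lowers
  both \<open>d\<close> and \<open>card S\<close> by one, so the bound on \<open>d + e\<close>
  survives. The candidates for \<open>p a\<close> exclude \<open>b\<close>, which lies in another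
  cycle. For \<open>d = 1\<close> the point \<open>a\<close> itself is removed, and only the cycle
  length of \<open>b\<close> remains to be prescribed.\<close>

lemma card_permutes_disjoint_least_powers:
  assumes "finite S" "a \<in> S" "b \<in> S" "a \<noteq> b" "0 < d" "0 < e" "d + e \<le> card S"
  shows "card {p. p permutes S \<and> least_power p a = d \<and> (\<forall>j. (p ^^ j) b \<noteq> a) \<and> least_power p b = e}
    = fact (card S - 2)"
  using assms(5,1-3,7)
proof (induction d arbitrary: S rule: nat_induct_non_zero)
  case 1
  have "(\<forall>j. (p ^^ j) b \<noteq> a)" if "p permutes S - {a}" for p
    using funpow_eq_fixed_iff[OF permutes_inj[OF that]] permutes_not_in[OF that, of a] assms(4)
    by auto
  then have "{p. p permutes S \<and> least_power p a = 1 \<and> (\<forall>j. (p ^^ j) b \<noteq> a) \<and> least_power p b = e}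
    = {p. p permutes S - {a} \<and> least_power p b = e}"
    using permutes_least_power_eq_1_iff[OF 1(1,2)] by blast
  then show ?case
    using 1 assms(4,6) by (simp add: card_permutes_least_power numeral_2_eq_2)
next
  case (Suc d)
  let ?Q = "\<lambda>d p. least_power p a = d \<and> (\<forall>j. (p ^^ j) b \<noteq> a) \<and> least_power p b = e"
  have perm: "permutation p" if "p permutes T" "T \<subseteq> S" for p T
    using that Suc.prems(1) finite_subset by (auto simp: permutation_permutes)
  have card: "card (S - {a, b}) = card S - 2"
    using Suc.prems(1-3) assms(4) by (simp add: card_Diff_subset numeral_2_eq_2)
  have "p a \<in> S - {a, b}" if p: "p permutes S" "?Q (Suc d) p" for p
  proof -
    have "p a \<noteq> a"
      using p least_power_eq_1_iff[OF perm[of p S], of a] Suc.hyps by auto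
    moreover have "p a \<noteq> b"
    proof
      assume "p a = b"
      then have "(p ^^ d) b = (p ^^ Suc d) a"
        by (simp add: funpow_swap1)
      also have "\<dots> = a"
        using least_power_of_permutation(1)[OF perm[of p S], of a] p by simp
      finally show False using p by blast
    qed
    ultimately show ?thesis
      using p Suc.prems by (auto simp: permutes_in_image)
  qed
  then have "card {p. p permutes S \<and> ?Q (Suc d) p}
    = (\<Sum>c\<in>S - {a, b}. card {q. q permutes S - {c} \<and> ?Q (Suc d) (insert_after a c q)})"
    using Suc.prems by (intro card_permutes_image_in) auto
  also have "\<dots> = (\<Sum>c\<in>S - {a, b}. card {q. q permutes S - {c} \<and> ?Q d q})"
  proof (intro sum.cong arg_cong[where f = card] Collect_cong conj_cong refl)
    fix c q assume c: "c \<in> S - {a, b}" and q: "q permutes S - {c}"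
    then have qc: "permutation q" "inj q" "q c = c" "c \<noteq> a" "b \<noteq> c"
      using perm[OF q] permutes_inj[OF q] permutes_not_in[OF q] by auto
    show "least_power (insert_after a c q) a = Suc d \<longleftrightarrow> least_power q a = d"
      using qc by (simp add: least_power_insert_after)
    show "(\<forall>j. (insert_after a c q ^^ j) b \<noteq> a) \<longleftrightarrow> (\<forall>j. (q ^^ j) b \<noteq> a)"
      using qc by (intro insert_after_avoids_iff)
    show "least_power (insert_after a c q) b = e \<longleftrightarrow> least_power q b = e" if "\<forall>j. (q ^^ j) b \<noteq> a"
      using qc that by (simp add: least_power_insert_after_avoiding)
  qed
  also have "\<dots> = (\<Sum>c\<in>S - {a, b}. fact (card S - 3))"
    using Suc.prems assms(4) by (intro sum.cong) (auto simp: Suc.IH numeral_eq_Suc)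
  also have "\<dots> = (card S - 2) * fact (card S - 3)"
    using card by simp
  also have "\<dots> = fact (card S - 2)"
    using Suc.prems Suc.hyps assms(6) fact_reduce[of "card S - 2", where 'a = nat]
    by (simp add: numeral_eq_Suc)
  finally show ?case .
qed

text \<open>Deleting \<open>p a\<close> lowers the cycle length and the offset \<open>j\<close>
  together, until \<open>j = 1\<close>. Then \<open>p a = b\<close> is forced, the deleted point is
  \<open>b\<close> itself, and only the cycle length of \<open>a\<close> remains to be
  prescribed.\<close>

lemma card_permutes_least_power_funpow:
  assumes "finite S" "a \<in> S" "b \<in> S" "a \<noteq> b" "0 < j" "j < d" "d \<le> card S"
  shows "card {p. p permutes S \<and> least_power p a = d \<and> (p ^^ j) a = b} = fact (card S - 2)"
  using assms(1-3,5-7)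
proof (induction d arbitrary: S j)
  case (Suc d)
  have perm: "permutation p" if "p permutes T" "T \<subseteq> S" for p T
    using that Suc.prems(1) finite_subset by (auto simp: permutation_permutes)
  have card: "card (S - {a, b}) = card S - 2"
    using Suc.prems(1-3) assms(4) by (simp add: card_Diff_subset numeral_2_eq_2)
  have notfix: "p a \<in> S - {a}" if "p permutes S" "least_power p a = Suc d" for p
    using that least_power_eq_1_iff[OF perm[of p S], of a] Suc.prems
    by (auto simp: permutes_in_image)
  show ?case
  proof (cases "j = 1")
    case True
    have "card {p. p permutes S \<and> least_power p a = Suc d \<and> (p ^^ j) a = b}
      = (\<Sum>c\<in>{b}. card {q. q permutes S - {c} \<and> least_power (insert_after a c q) a = Suc d
          \<and> (insert_after a c q ^^ j) a = b})"
      using Suc.prems assms(4) True by (intro card_permutes_image_in) auto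
    also have "\<dots> = card {q. q permutes S - {b} \<and> least_power q a = d}"
      unfolding sum.insert_remove[OF finite.emptyI]
      using True assms(4) permutes_not_in[of _ "S - {b}" b]
      by (auto simp: least_power_insert_after perm insert_after_apply intro!: arg_cong[where f = card])
    also have "\<dots> = fact (card S - 2)"
      using Suc.prems assms(4) by (simp add: card_permutes_least_power numeral_2_eq_2)
    finally show ?thesis .
  next
    case False
    then obtain i where i: "j = Suc i" "0 < i"
      using Suc.prems by (cases j) auto
    have "p a \<noteq> b" if "p permutes S" "least_power p a = Suc d" "(p ^^ j) a = b" for p
    proof
      assume "p a = b"
      then have "p ((p ^^ i) a) = p a"
        using that i by simp
      then have "(p ^^ i) a = a"
        using permutes_inj[OF \<open>p permutes S\<close>] by (simp add: inj_eq)
      then show False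
        using funpow_neq_below_least_power[of i p a] that i Suc.prems by simp
    qed
    then have "card {p. p permutes S \<and> least_power p a = Suc d \<and> (p ^^ j) a = b}
      = (\<Sum>c\<in>S - {a, b}. card {q. q permutes S - {c} \<and> least_power (insert_after a c q) a = Suc d
          \<and> (insert_after a c q ^^ j) a = b})"
      using Suc.prems notfix by (intro card_permutes_image_in) auto
    also have "\<dots> = (\<Sum>c\<in>S - {a, b}. card {q. q permutes S - {c} \<and> least_power q a = d \<and> (q ^^ i) a = b})"
    proof (intro sum.cong arg_cong[where f = card] Collect_cong conj_cong refl)
      fix c q assume c: "c \<in> S - {a, b}" and q: "q permutes S - {c}"
      then have qc: "permutation q" "inj q" "q c = c" "c \<noteq> a"
        using perm[OF q] permutes_inj[OF q] permutes_not_in[OF q] by auto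
      show "least_power (insert_after a c q) a = Suc d \<longleftrightarrow> least_power q a = d"
        using qc by (simp add: least_power_insert_after)
      show "(insert_after a c q ^^ j) a = b \<longleftrightarrow> (q ^^ i) a = b" if "least_power q a = d"
        using funpow_insert_after[OF qc(2-4) i(2)] that i Suc.prems by simp
    qed
    also have "\<dots> = (\<Sum>c\<in>S - {a, b}. fact (card S - 3))"
      using Suc.prems i by (intro sum.cong) (auto simp: Suc.IH numeral_eq_Suc)
    also have "\<dots> = (card S - 2) * fact (card S - 3)"
      using card by simp
    also have "\<dots> = fact (card S - 2)"
      using Suc.prems i fact_reduce[of "card S - 2", where 'a = nat]
      by (simp add: numeral_eq_Suc)
    finally show ?thesis .
  qed
qed simp

section \<open>Powers that fix or exchange two given points\<close>

lemma funpow_mod_least_power: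
  assumes "permutation p"
  shows "(p ^^ (j mod least_power p a)) a = (p ^^ j) a"
  by (rule funpow_mod_eq) (rule least_power_of_permutation(1)[OF assms])

lemma funpow_inj_on_below_least_power:
  assumes "permutation p" "i < least_power p a" "j < least_power p a" "(p ^^ i) a = (p ^^ j) a"
  shows "i = j"
proof -
  have *: "i = j" if "i \<le> j" "j < least_power p a" "(p ^^ i) a = (p ^^ j) a" for i j
  proof -
    have "(p ^^ (j - i)) a = a"
      using that assms(1) permutation_bijective bij_is_inj by (blast intro: funpow_diff)
    then show ?thesis
      using funpow_neq_below_least_power[of "j - i" p a] that by (cases "j - i = 0") auto
  qed
  show ?thesis
    using *[of i j] *[of j i] assms by (cases "i \<le> j") auto
qed

lemma funpow_reaches_sym:
  assumes "permutation p"
  shows "(\<exists>j. (p ^^ j) b = a) \<longleftrightarrow> (\<exists>j. (p ^^ j) a = b)"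
proof -
  have "\<exists>i. (p ^^ i) a = b" if "(p ^^ j) b = a" for a b j
  proof -
    let ?m = "least_power p b"
    \<comment> \<open>Iterates run forward only. The way back from \<open>a\<close> to
      \<open>b\<close> completes \<open>?m * j\<close> steps, a multiple of the cycle length large
      enough for the subtraction of \<open>j\<close>.\<close>
    have "j \<le> ?m * j"
      using least_power_of_permutation(2)[OF assms, of b] by simp
    then have "(p ^^ (?m * j - j)) ((p ^^ j) b) = (p ^^ (?m * j)) b"
      by (metis add_diff_inverse_nat add.commute funpow_add o_apply not_le)
    also have "\<dots> = b"
      using least_power_dvd[OF assms, of b "?m * j"] by simp
    finally show ?thesis using that by blast
  qed
  then show ?thesis by blast
qed

text \<open>The sets \<open>A\<close> collect the permutations with the two points in different
  cycles of lengths \<open>d\<close> and \<open>e\<close>, the sets \<open>B\<close> those with both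
  in one cycle of length \<open>d\<close> at offset \<open>j\<close>; all lengths divide
  \<open>k\<close>. The bound \<open>2 * k \<le> card S\<close> leaves room for two such cycles. The
  term with \<open>tau k\<close> stands on the left to avoid truncated subtraction.\<close>

lemma card_permutes_funpow_fixing_pair:
  assumes "finite S" "a \<in> S" "b \<in> S" "a \<noteq> b" "0 < k" "2 * k \<le> card S"
  shows "card {p. p permutes S \<and> (p ^^ k) a = a \<and> (p ^^ k) b = b} + tau k * fact (card S - 2)
    = ((tau k)\<^sup>2 + sigma k) * fact (card S - 2)"
proof -
  define D where "D = {d. d dvd k}"
  define A where "A = (\<lambda>(d, e). {p. p permutes S \<and> least_power p a = d
    \<and> (\<forall>j. (p ^^ j) b \<noteq> a) \<and> least_power p b = e})"
  define B where "B = (\<lambda>(d, j). {p. p permutes S \<and> least_power p a = d \<and> (p ^^ j) a = b})"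
  let ?I = "SIGMA d:D. {0<..<d}"
  have perm: "permutation p" if "p permutes S" for p
    using that assms(1) by (auto simp: permutation_permutes)
  have fin: "finite D" "finite ?I" "\<And>x. finite (A x)" "\<And>x. finite (B x)"
    using assms(1,5) finite_permutations[OF assms(1)]
    by (auto simp: D_def A_def B_def intro: finite_subset[rotated])
  have D: "0 < d" "d \<le> k" if "d \<in> D" for d
    using that assms(5) by (auto simp: D_def dvd_imp_le dvd_pos_nat)
  have "{p. p permutes S \<and> (p ^^ k) a = a \<and> (p ^^ k) b = b} = (\<Union>(A ` (D \<times> D))) \<union> (\<Union>(B ` ?I))"
  proof (intro equalityI subsetI)
    fix p assume "p \<in> {p. p permutes S \<and> (p ^^ k) a = a \<and> (p ^^ k) b = b}"
    then have p: "p permutes S" "least_power p a \<in> D" "least_power p b \<in> D"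
      by (auto simp: D_def least_power_minimal)
    show "p \<in> (\<Union>(A ` (D \<times> D))) \<union> (\<Union>(B ` ?I))"
    proof (cases "\<exists>j. (p ^^ j) b = a")
      case True
      then obtain j where "(p ^^ j) a = b"
        using funpow_reaches_sym[OF perm[OF p(1)]] by blast
      then have j: "(p ^^ (j mod least_power p a)) a = b"
        using funpow_mod_least_power[OF perm[OF p(1)]] by simp
      then have "0 < j mod least_power p a"
        using assms(4) by (cases "j mod least_power p a") auto
      then have "(least_power p a, j mod least_power p a) \<in> ?I"
        using p(2) D by auto
      moreover have "p \<in> B (least_power p a, j mod least_power p a)"
        using j p(1) by (simp add: B_def)
      ultimately show ?thesis by blast
    next
      case False
      then have "p \<in> A (least_power p a, least_power p b)"
        using p(1) by (simp add: A_def)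
      then show ?thesis using p(2,3) by blast
    qed
  next
    fix p assume "p \<in> (\<Union>(A ` (D \<times> D))) \<union> (\<Union>(B ` ?I))"
    then consider d e where "p \<in> A (d, e)" "d \<in> D" "e \<in> D"
      | d j where "p \<in> B (d, j)" "d \<in> D"
      by blast
    then show "p \<in> {p. p permutes S \<and> (p ^^ k) a = a \<and> (p ^^ k) b = b}"
    proof cases
      case 1
      then show ?thesis
        using least_power_dvd[OF perm] by (auto simp: A_def D_def)
    next
      case 2
      then have p: "p permutes S" "(p ^^ k) a = a" "(p ^^ j) a = b"
        using least_power_dvd[OF perm] by (auto simp: B_def D_def)
      \<comment> \<open>The iterates of \<open>p\<close> commute, so a power that fixes
        \<open>a\<close> fixes every point of its orbit.\<close>
      then have "(p ^^ k) b = b"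
        by (metis add.commute funpow_add o_apply)
      then show ?thesis using p by simp
    qed
  qed
  moreover have "(\<Union>(A ` (D \<times> D))) \<inter> (\<Union>(B ` ?I)) = {}"
  proof -
    have "p \<notin> B y" if "p \<in> A x" for p x y
      using that funpow_reaches_sym[OF perm, of p b a] by (auto simp: A_def B_def)
    then show ?thesis by blast
  qed
  moreover have "card (\<Union>(A ` (D \<times> D))) = (\<Sum>x\<in>D \<times> D. card (A x))"
    using fin by (intro card_UN_disjoint) (auto simp: A_def)
  moreover have "(\<Sum>x\<in>D \<times> D. card (A x)) = (\<Sum>x\<in>D \<times> D. fact (card S - 2))"
  proof (rule sum.cong)
    fix x assume "x \<in> D \<times> D"
    then obtain d e where x: "x = (d, e)" "d \<in> D" "e \<in> D" by blast
    then have "0 < d" "0 < e" "d + e \<le> card S"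
      using D[of d] D[of e] assms(6) by auto
    then show "card (A x) = fact (card S - 2)"
      unfolding A_def x using assms(1-4) by (simp add: card_permutes_disjoint_least_powers)
  qed simp
  moreover have "card (\<Union>(B ` ?I)) = (\<Sum>x\<in>?I. card (B x))"
  proof (intro card_UN_disjoint ballI impI)
    fix x y assume xy: "x \<in> ?I" "y \<in> ?I" "x \<noteq> y"
    show "B x \<inter> B y = {}"
      \<comment> \<open>An offset below the cycle length is determined by the point it
        reaches.\<close>
      using xy funpow_inj_on_below_least_power[OF perm, of _ "snd x" a "snd y"]
      by (fastforce simp: B_def)
  qed (use fin in auto)
  moreover have "(\<Sum>x\<in>?I. card (B x)) = (\<Sum>x\<in>?I. fact (card S - 2))"
  proof (rule sum.cong)
    fix x assume "x \<in> ?I"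
    then obtain d j where x: "x = (d, j)" "d \<in> D" "0 < j" "j < d" by auto
    moreover have "d \<le> card S"
      using D[OF x(2)] assms(6) by simp
    ultimately show "card (B x) = fact (card S - 2)"
      unfolding B_def using assms(1-4) by (simp add: card_permutes_least_power_funpow)
  qed simp
  moreover have "card (D \<times> D) = (tau k)\<^sup>2"
    by (simp add: D_def tau_def card_cartesian_product power2_eq_square)
  moreover have "card ?I + tau k = sigma k"
  proof -
    \<comment> \<open>A cycle of length \<open>d\<close> offers \<open>d - 1\<close> nonzero
      offsets; one more per divisor completes the sum of divisors.\<close>
    have "card ?I + tau k = (\<Sum>d\<in>D. (d - 1) + 1)"
      using fin(1) by (simp only: sum.distrib tau_def D_def[symmetric]) simp
    also have "\<dots> = sigma k"
      unfolding sigma_def using D by (intro sum.cong) (auto simp: D_def)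
    finally show ?thesis .
  qed
  moreover have "finite (\<Union>(A ` (D \<times> D)))" "finite (\<Union>(B ` ?I))"
    using fin by auto
  ultimately have "card {p. p permutes S \<and> (p ^^ k) a = a \<and> (p ^^ k) b = b}
    = ((tau k)\<^sup>2 + card ?I) * fact (card S - 2)"
    by (simp only: card_Un_disjoint sum_constant of_nat_id distrib_right)
  then show ?thesis
    using \<open>card ?I + tau k = sigma k\<close>[symmetric] by (simp only: distrib_right add.assoc)
qed

text \<open>An exchange puts both points in one cycle, whose length \<open>m\<close> divides
  \<open>2 * k\<close> but not \<open>k\<close>. Conversely, for such \<open>m\<close>, sending
  \<open>a\<close> to \<open>b\<close> is enough, because the power \<open>2 * k\<close> brings
  \<open>a\<close> back.\<close>

lemma card_permutes_funpow_swapping_pair: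
  assumes "finite S" "a \<in> S" "b \<in> S" "a \<noteq> b" "0 < k" "2 * k \<le> card S"
  shows "card {p. p permutes S \<and> (p ^^ k) a = b \<and> (p ^^ k) b = a}
    = card {m. m dvd 2 * k \<and> \<not> m dvd k} * fact (card S - 2)"
proof -
  define M where "M = {m. m dvd 2 * k \<and> \<not> m dvd k}"
  \<comment> \<open>The exponent \<open>k\<close> may exceed the cycle length, so it is reduced to
    the offset \<open>k mod m\<close>, which is positive because \<open>m\<close> does not divide
    \<open>k\<close>.\<close>
  define B where "B = (\<lambda>m. {p. p permutes S \<and> least_power p a = m \<and> (p ^^ (k mod m)) a = b})"
  have perm: "permutation p" if "p permutes S" for p
    using that assms(1) by (auto simp: permutation_permutes)
  have fin: "finite M" "\<And>m. finite (B m)"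
    using assms(1,5) finite_permutations[OF assms(1)]
    by (auto simp: M_def B_def intro: finite_subset[rotated])
  have "{p. p permutes S \<and> (p ^^ k) a = b \<and> (p ^^ k) b = a} = \<Union>(B ` M)"
  proof (intro equalityI subsetI)
    fix p assume "p \<in> {p. p permutes S \<and> (p ^^ k) a = b \<and> (p ^^ k) b = a}"
    then have p: "p permutes S" "(p ^^ k) a = b" "(p ^^ k) b = a" by auto
    then have "(p ^^ (2 * k)) a = a"
      by (simp add: mult_2 funpow_add)
    then have "least_power p a \<in> M"
      using p assms(4) least_power_dvd[OF perm[OF p(1)], of a] by (auto simp: M_def)
    moreover have "p \<in> B (least_power p a)"
      using p funpow_mod_least_power[OF perm[OF p(1)]] by (simp add: B_def)
    ultimately show "p \<in> \<Union>(B ` M)" by blast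
  next
    fix p assume "p \<in> \<Union>(B ` M)"
    then have p: "p permutes S" "least_power p a \<in> M" "(p ^^ k) a = b"
      using funpow_mod_least_power[OF perm] by (auto simp: B_def)
    then have "(p ^^ (2 * k)) a = a"
      using least_power_dvd[OF perm[OF p(1)], of a] by (auto simp: M_def)
    then show "p \<in> {p. p permutes S \<and> (p ^^ k) a = b \<and> (p ^^ k) b = a}"
      using p by (simp add: mult_2 funpow_add)
  qed
  also have "card \<dots> = (\<Sum>m\<in>M. card (B m))"
    using fin by (intro card_UN_disjoint) (auto simp: B_def)
  also have "\<dots> = (\<Sum>m\<in>M. fact (card S - 2))"
  proof (rule sum.cong)
    fix m assume m: "m \<in> M"
    then have "0 < m" "m \<le> 2 * k"
      using assms(5) dvd_pos_nat[of "2 * k" m] dvd_imp_le[of m "2 * k"] by (auto simp: M_def)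
    moreover have "0 < k mod m"
      using m by (auto simp: M_def mod_greater_zero_iff_not_dvd)
    ultimately show "card (B m) = fact (card S - 2)"
      unfolding B_def using assms by (intro card_permutes_least_power_funpow) auto
  qed simp
  finally show ?thesis by (simp add: M_def)
qed

text \<open>Doubling \<open>k\<close> raises the exponent \<open>v\<close> of 2 by one and keeps the
  odd part \<open>q\<close>. The new divisors are those with the full power
  \<open>2 ^ Suc v\<close>, one for each divisor of \<open>q\<close>.\<close>

lemma card_dvd_double_not_dvd:
  assumes "0 < k"
  shows "card {m. m dvd 2 * k \<and> \<not> m dvd k} = tau_odd k"
proof -
  define v where "v = multiplicity 2 k"
  define q where "q = k div 2 ^ v"
  have k: "k = 2 ^ v * q"
    using multiplicity_dvd[of 2 k] by (simp add: v_def q_def)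
  have odd: "odd q"
    using multiplicity_decompose[of k 2] assms by (simp add: q_def v_def)
  have "{m. m dvd 2 * k \<and> \<not> m dvd k} = (*) (2 ^ Suc v) ` {d. d dvd q}"
  proof (intro equalityI subsetI)
    fix m assume m: "m \<in> {m. m dvd 2 * k \<and> \<not> m dvd k}"
    then have "m dvd 2 ^ Suc v * q" unfolding k by (simp add: mult.assoc)
    then obtain x y where xy: "m = x * y" "x dvd 2 ^ Suc v" "y dvd q"
      using division_decomp by blast
    then obtain i where i: "x = 2 ^ i" "i \<le> Suc v"
      using divides_primepow_nat[of 2 x "Suc v"] by (auto simp: two_is_prime_nat)
    have "\<not> i \<le> v"
      using m xy i by (auto simp: k intro: mult_dvd_mono le_imp_power_dvd)
    then have "i = Suc v" using i by simp
    then show "m \<in> (*) (2 ^ Suc v) ` {d. d dvd q}"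
      using xy i by blast
  next
    fix m assume "m \<in> (*) (2 ^ Suc v) ` {d. d dvd q}"
    then obtain d where d: "m = 2 ^ Suc v * d" "d dvd q" by blast
    have "\<not> 2 * d dvd q"
      using odd dvd_mult_left by blast
    then have "\<not> m dvd k"
      using d by (simp add: k mult.assoc mult.left_commute[of 2])
    then show "m \<in> {m. m dvd 2 * k \<and> \<not> m dvd k}"
      using d by (simp add: k)
  qed
  moreover have "inj_on ((*) (2 ^ Suc v)) {d. d dvd q}"
    by (rule inj_onI) simp
  ultimately show ?thesis
    by (simp add: card_image tau_odd_def tau_def q_def v_def)
qed

section \<open>Descents under conjugation by an adjacent transposition\<close>

lemma funpow_conj_involution:
  assumes "t \<circ> t = id"
  shows "(t \<circ> f \<circ> t) ^^ k = t \<circ> f ^^ k \<circ> t"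
proof
  show "((t \<circ> f \<circ> t) ^^ k) x = (t \<circ> f ^^ k \<circ> t) x" for x
    by (induction k) (simp_all add: pointfree_idE[OF assms])
qed

text \<open>Conjugation swaps the two positions and also exchanges the values \<open>i\<close> and
  \<open>i + 1\<close>. Exchanging adjacent values alters the order of a pair only if the pair
  consists of exactly these values. In all other cases just the position swap counts, and precisely
  one of the two maps has a descent; in the exceptional cases the conjugate agrees with
  \<open>g\<close> at both positions.\<close>

lemma of_bool_descent_conj_transpose:
  fixes g :: "nat \<Rightarrow> nat"
  assumes "inj g"
  shows "of_bool (g i > g (i + 1))
      + of_bool ((transpose i (i + 1) \<circ> g \<circ> transpose i (i + 1)) i
          > (transpose i (i + 1) \<circ> g \<circ> transpose i (i + 1)) (i + 1))
      + of_bool (g i = i \<and> g (i + 1) = i + 1)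
    = (1 :: nat) + of_bool (g i = i + 1 \<and> g (i + 1) = i)"
proof -
  have "g i \<noteq> g (i + 1)"
    using assms by (simp add: inj_eq)
  then show ?thesis
    by (cases "g i = i"; cases "g i = i + 1"; cases "g (i + 1) = i"; cases "g (i + 1) = i + 1")
      (simp_all add: transpose_def of_bool_def)
qed

text \<open>Conjugation permutes the permutations of \<open>S\<close>, so summing the pointwise
  identity over all of them counts the descents at \<open>i\<close> twice.\<close>

lemma double_card_descent_at:
  fixes i k :: nat
  assumes "finite S" "i \<in> S" "i + 1 \<in> S"
  shows "2 * card {p. p permutes S \<and> (p ^^ k) i > (p ^^ k) (i + 1)}
      + card {p. p permutes S \<and> (p ^^ k) i = i \<and> (p ^^ k) (i + 1) = i + 1}
    = fact (card S) + card {p. p permutes S \<and> (p ^^ k) i = i + 1 \<and> (p ^^ k) (i + 1) = i}"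
proof -
  define t where "t = transpose i (i + 1)"
  define \<phi> where "\<phi> = (\<lambda>p. t \<circ> p \<circ> t)"
  define P where "P = {p. p permutes S}"
  define desc where "desc = (\<lambda>p :: nat \<Rightarrow> nat. (p ^^ k) i > (p ^^ k) (i + 1))"
  have t: "t permutes S" "t \<circ> t = id"
    using assms by (auto simp: t_def intro: permutes_swap_id)
  have fin: "finite P"
    using assms(1) by (simp add: P_def finite_permutations)
  have count: "card {p. p permutes S \<and> Q p} = (\<Sum>p\<in>P. of_bool (Q p))" for Q
    using fin by (simp add: P_def Int_def)
  have "\<phi> (\<phi> p) = p" for p
  proof -
    have "\<phi> (\<phi> p) = (t \<circ> t) \<circ> p \<circ> (t \<circ> t)"
      by (simp only: \<phi>_def o_assoc)
    then show ?thesis by (simp add: t)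
  qed
  moreover have "\<phi> \<in> P \<rightarrow> P"
    using t(1) by (auto simp: P_def \<phi>_def intro!: permutes_compose)
  ultimately have "bij_betw \<phi> P P"
    by (intro bij_betwI[where g = \<phi>]) auto
  then have "(\<Sum>p\<in>P. of_bool (desc (\<phi> p))) = (\<Sum>p\<in>P. of_bool (desc p) :: nat)"
    by (rule sum.reindex_bij_betw)
  then have "2 * (\<Sum>p\<in>P. of_bool (desc p) :: nat)
      + (\<Sum>p\<in>P. of_bool ((p ^^ k) i = i \<and> (p ^^ k) (i + 1) = i + 1))
    = (\<Sum>p\<in>P. of_bool (desc p) + of_bool (desc (\<phi> p))
      + of_bool ((p ^^ k) i = i \<and> (p ^^ k) (i + 1) = i + 1))"
    by (simp add: sum.distrib)
  also have "\<dots> = (\<Sum>p\<in>P. 1 + of_bool ((p ^^ k) i = i + 1 \<and> (p ^^ k) (i + 1) = i))"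
  proof (rule sum.cong)
    fix p assume "p \<in> P"
    then have "inj (p ^^ k)"
      by (intro inj_fn) (auto simp: P_def permutes_inj)
    moreover have "\<phi> p ^^ k = t \<circ> p ^^ k \<circ> t"
      unfolding \<phi>_def using t(2) by (rule funpow_conj_involution)
    ultimately show "of_bool (desc p) + of_bool (desc (\<phi> p))
        + of_bool ((p ^^ k) i = i \<and> (p ^^ k) (i + 1) = i + 1)
      = (1 :: nat) + of_bool ((p ^^ k) i = i + 1 \<and> (p ^^ k) (i + 1) = i)"
      using of_bool_descent_conj_transpose[of "p ^^ k" i] by (simp only: desc_def t_def)
  qed simp
  also have "\<dots> = fact (card S) + (\<Sum>p\<in>P. of_bool ((p ^^ k) i = i + 1 \<and> (p ^^ k) (i + 1) = i))"
    unfolding sum.distrib using assms(1) by (simp add: P_def card_permutations)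
  finally show ?thesis
    unfolding count desc_def .
qed

section \<open>Summation over the positions\<close>

lemma sum_des_eq_sum_card:
  assumes "finite P"
  shows "(\<Sum>p\<in>P. des n (f p)) = (\<Sum>i = 1..n - 1. card {p \<in> P. f p i > f p (i + 1)})"
proof -
  have "(\<Sum>p\<in>P. des n (f p)) = (\<Sum>p\<in>P. \<Sum>i = 1..n - 1. of_bool (f p i > f p (i + 1)))"
    by (simp add: des_def descents_def Int_def)
  also have "\<dots> = (\<Sum>i = 1..n - 1. \<Sum>p\<in>P. of_bool (f p i > f p (i + 1)))"
    by (rule sum.swap)
  also have "\<dots> = (\<Sum>i = 1..n - 1. card {p \<in> P. f p i > f p (i + 1)})"
    using assms by (simp add: Int_def)
  finally show ?thesis .
qed

theorem theorem1p1:
  fixes k n :: nat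
  assumes "k \<ge> 1" and "n \<ge> 2 * k + 1"
  shows "1 / fact n * (\<Sum>\<pi> | \<pi> permutes {1..n}. real (des n (\<pi> ^^ k)))
    = (real n - 1) / 2
      - ((real (tau k))\<^sup>2 - real (tau k) - real (tau_odd k) + real (sigma k)) / (2 * real n)"
proof -
  let ?D = "\<lambda>i. card {p. p permutes {1..n} \<and> (p ^^ k) i > (p ^^ k) (i + 1)}"
  define F :: real where "F = fact (n - 2)"
  define c where "c = (real (tau k))\<^sup>2 - real (tau k) - real (tau_odd k) + real (sigma k)"
  \<comment> \<open>The assumptions give \<open>n \<ge> 3\<close>, so two factors split off the
    factorial and the subtractions are exact.\<close>
  have F: "F > 0" "fact n = real n * (real n - 1) * F"
    using assms fact_reduce[of n, where 'a = real] fact_reduce[of "n - 1", where 'a = real]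
    by (simp_all add: F_def numeral_2_eq_2 of_nat_diff)
  \<comment> \<open>The count is the same at every position, which makes the final sum a
    multiplication by \<open>n - 1\<close>.\<close>
  have D: "real (?D i) = (fact n - c * F) / 2" if i: "i \<in> {1..n - 1}" for i
  proof -
    let ?fix = "card {p. p permutes {1..n} \<and> (p ^^ k) i = i \<and> (p ^^ k) (i + 1) = i + 1}"
    let ?swap = "card {p. p permutes {1..n} \<and> (p ^^ k) i = i + 1 \<and> (p ^^ k) (i + 1) = i}"
    have mem: "i \<in> {1..n}" "i + 1 \<in> {1..n}" "i \<noteq> i + 1"
      using i assms by auto
    have k: "0 < k" "2 * k \<le> card {1..n}"
      using assms by auto
    have "?fix + tau k * fact (n - 2) = ((tau k)\<^sup>2 + sigma k) * fact (n - 2)"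
      using card_permutes_funpow_fixing_pair[OF _ mem k] by simp
    from arg_cong[OF this, of real]
    have "real ?fix + tau k * F = ((real (tau k))\<^sup>2 + sigma k) * F"
      unfolding F_def by (simp only: of_nat_add of_nat_mult of_nat_power of_nat_fact)
    moreover have "real ?swap = tau_odd k * F"
      using card_permutes_funpow_swapping_pair[OF _ mem k] card_dvd_double_not_dvd[OF k(1)]
      by (simp add: F_def)
    moreover have "2 * real (?D i) + ?fix = fact n + real ?swap"
    proof -
      have "2 * ?D i + ?fix = fact n + ?swap"
        using double_card_descent_at[OF _ mem(1,2), of k] by simp
      from arg_cong[OF this, of real] show ?thesis
        by (simp only: of_nat_add of_nat_mult of_nat_numeral of_nat_fact)
    qed
    ultimately have "2 * real (?D i) = fact n - c * F"
      unfolding c_def distrib_right left_diff_distrib by linarith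
    then show ?thesis
      by (metis nonzero_mult_div_cancel_left zero_neq_numeral)
  qed
  have "(\<Sum>p | p permutes {1..n}. des n (p ^^ k)) = (\<Sum>i = 1..n - 1. ?D i)"
    using sum_des_eq_sum_card[of "{p. p permutes {1..n}}" n "\<lambda>p. p ^^ k"]
    by (simp add: finite_permutations)
  from arg_cong[OF this, of real]
  have "(\<Sum>p | p permutes {1..n}. real (des n (p ^^ k))) = (\<Sum>i = 1..n - 1. real (?D i))"
    by (simp only: of_nat_sum)
  also have "\<dots> = (\<Sum>i = 1..n - 1. (fact n - c * F) / 2)"
    using D by (rule sum.cong[OF refl])
  also have "\<dots> = (real n - 1) * ((fact n - c * F) / 2)"
    using assms by (simp add: of_nat_diff)
  finally have "1 / fact n * (\<Sum>p | p permutes {1..n}. real (des n (p ^^ k)))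
    = 1 / (real n * (real n - 1) * F) * ((real n - 1) * ((real n * (real n - 1) * F - c * F) / 2))"
    unfolding F(2) by (rule arg_cong)
  also have "\<dots> = (real n - 1) / 2 - c / (2 * real n)"
  proof -
    \<comment> \<open>Here \<open>x\<close> and \<open>y\<close> stand for \<open>n\<close> and
      \<open>n - 1\<close>; as positive atoms they can be cancelled directly.\<close>
    have "1 / (x * y * F) * (y * ((x * y * F - c * F) / 2)) = y / 2 - c / (2 * x)"
      if "x > 0" "y > 0" for x y
      using that F(1) by (simp add: field_simps)
    from this[of "real n" "real n - 1"] show ?thesis using assms by simp
  qed
  finally show ?thesis unfolding c_def .
qed

end
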